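(* Let $(\mathfrak g,[\cdot,\cdot]_{\mathfrak g},\phi_{\mathfrak g})$ be a Hom-Lie algebra. Then $$\mathcal H^1(\mathfrak g,\mathsf{ad})=\mathsf{Out}(\mathfrak g).$$
   Context: Vector spaces are over a fixed ground field. A Hom-Lie algebra $(\mathfrak g,[\cdot,\cdot]_{\mathfrak g},\phi_{\mathfrak g})$ is a vector space $\mathfrak g$ with a skew-symmetric bilinear bracket (a linear map on $\wedge^2\mathfrak g$) and a linear map $\phi_{\mathfrak g}:\mathfrak g\to\mathfrak g$ preserving the bracket, such that $[\phi_{\mathfrak g}(x),[y,z]_{\mathfrak g}]_{\mathfrak g}+[\phi_{\mathfrak g}(y),[z,x]_{\mathfrak g}]_{\mathfrak g}+[\phi_{\mathfrak g}(z),[x,y]_{\mathfrak g}]_{\mathfrak g}=0$. Throughout, $\phi_{\mathfrak g}$ is assumed to be an algebra automorphism. For a linear automorphism $\beta$ of $V$ and $A\in\mathfrak{gl}(V)$, $\mathsf{Ad}_\beta(A)=\beta\circ A\circ\beta^{-1}$. A derivation of $\mathfrak g$ is a linear map $D:\mathfrak g\to\mathfrak g$ with $D[x,y]_{\mathfrak g}=[\phi_{\mathfrak g}(x),(\mathsf{Ad}_{\phi_{\mathfrak g}^{-1}}D)(y)]_{\mathfrak g}+[(\mathsf{Ad}_{\phi_{\mathfrak g}^{-1}}D)(x),\phi_{\mathfrak g}(y)]_{\mathfrak g}$ for all $x,y\in\mathfrak g$; $\mathsf{Der}(\mathfrak g)$ is the space of derivations. With $\mathsf{ad}_x(y)=[x,y]_{\mathfrak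 g}$, each $\mathsf{ad}_x$ is a derivation; $\mathsf{Inn}(\mathfrak g)=\{\mathsf{ad}_x\mid x\in\mathfrak g\}$ and $\mathsf{Out}(\mathfrak g)=\mathsf{Der}(\mathfrak g)/\mathsf{Inn}(\mathfrak g)$. A representation $(\rho,V,\beta)$ of $\mathfrak g$ is a vector space $V$, $\beta\in\mathfrak{gl}(V)$ and a linear map $\rho:\mathfrak g\to\mathfrak{gl}(V)$ with $\rho(\phi_{\mathfrak g}(x))\circ\beta=\beta\circ\rho(x)$ and $\rho([x,y]_{\mathfrak g})\circ\beta=\rho(\phi_{\mathfrak g}(x))\circ\rho(y)-\rho(\phi_{\mathfrak g}(y))\circ\rho(x)$. The cohomology of $\mathfrak g$ with coefficients in $V$ is that of the cochain complex $C^k(\mathfrak g,V)=\mathrm{Hom}(\wedge^k\mathfrak g,V)$, $k\ge0$, with $$(df)(x_1,\dots,x_{k+1})=\sum_{i=1}^{k+1}(-1)^{i+1}\rho(x_i)\bigl(f(\phi_{\mathfrak g}^{-1}x_1,\dots,\widehat{\phi_{\mathfrak g}^{-1}x_i},\dots,\phi_{\mathfrak g}^{-1}x_{k+1})\bigr)+\sum_{i<j}(-1)^{i+j}\beta f([\phi_{\mathfrak g}^{-2}x_i,\phi_{\mathfrak g}^{-2}x_j]_{\mathfrak g},\phi_{\mathfrak g}^{-1}x_1,\dots,\widehat{\phi_{\mathfrak g}^{-1}x_i},\dots,\widehat{\phi_{\mathfrak g}^{-1}x_j},\dots,\phi_{\mathfrak g}^{-1}x_{k+1}).$$ $\mathcal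 H^k(\mathfrak g,\rho)$ is the space of $k$-cocycles modulo the space of $k$-coboundaries. The adjoint representation is $(\mathsf{ad},\mathfrak g,\phi_{\mathfrak g})$; for it, $C^0(\mathfrak g,\mathfrak g)=\mathfrak g$ and $(dx)(y)=[y,x]_{\mathfrak g}$. *)

theory Defs
  imports Complex_Main "HOL-Library.FuncSet" "HOL-Library.Function_Algebras"
begin

section \<open>Quotients of vector spaces\<close>

text \<open>A quotient space is a structure whose elements are cosets, so it does not live on a whole type;
  we record its carrier together with its linear structure.\<close>

record ('k, 'a) linear_structure =
  points :: "'a set"
  add :: "'a \<Rightarrow> 'a \<Rightarrow> 'a"
  zero :: "'a"
  smul :: "'k \<Rightarrow> 'a \<Rightarrow> 'a"

definition coset :: "'a::ab_group_add \<Rightarrow> 'a set \<Rightarrow> 'a set"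
  where "coset w U = (\<lambda>u. w + u) ` U"

text \<open>The quotient of \<open>W\<close> by the subspace \<open>U \<subseteq> W\<close>. The summand \<open>u\<close> in the scalar
  multiplication only matters for the scalar \<open>0\<close>.\<close>

definition quotient_space ::
  "('k \<Rightarrow> 'a::ab_group_add \<Rightarrow> 'a) \<Rightarrow> 'a set \<Rightarrow> 'a set \<Rightarrow> ('k, 'a set) linear_structure"
  where "quotient_space s W U =
    \<lparr> points = (\<lambda>w. coset w U) ` W,
      add = (\<lambda>A B. {a + b |a b. a \<in> A \<and> b \<in> B}),
      zero = U,
      smul = (\<lambda>c A. {s c a + u |a u. a \<in> A \<and> u \<in> U}) \<rparr>"

lemma (in module) quotient_space_add:
  assumes U: "subspace U"
  shows "add (quotient_space scale W U) (coset v U) (coset w U) = coset (v + w) U"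
proof -
  have "{a + b |a b. a \<in> coset v U \<and> b \<in> coset w U} = coset (v + w) U" (is "?L = ?R")
  proof
    show "?L \<subseteq> ?R"
    proof
      fix y assume "y \<in> ?L"
      then obtain u u' where "u \<in> U" "u' \<in> U" "y = (v + u) + (w + u')"
        by (auto simp: coset_def)
      then have "u + u' \<in> U" "y = v + w + (u + u')"
        using subspace_add[OF U] by (auto simp: algebra_simps)
      then show "y \<in> ?R" by (auto simp: coset_def)
    qed
    show "?R \<subseteq> ?L"
    proof
      fix y assume "y \<in> ?R"
      then obtain u where "u \<in> U" "y = (v + u) + (w + 0)"
        by (auto simp: coset_def algebra_simps)
      then show "y \<in> ?L" using subspace_0[OF U] unfolding coset_def by blast
    qed
  qed
  then show ?thesis by (simp add: quotient_space_def)
qed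

lemma (in module) quotient_space_smul:
  assumes U: "subspace U"
  shows "smul (quotient_space scale W U) c (coset w U) = coset (scale c w) U"
proof -
  have "{scale c a + u |a u. a \<in> coset w U \<and> u \<in> U} = coset (scale c w) U" (is "?L = ?R")
  proof
    show "?L \<subseteq> ?R"
    proof
      fix y assume "y \<in> ?L"
      then obtain u u' where "u \<in> U" "u' \<in> U" "y = scale c (w + u) + u'"
        by (auto simp: coset_def)
      then have "scale c u + u' \<in> U" "y = scale c w + (scale c u + u')"
        using subspace_add[OF U] subspace_scale[OF U]
        by (auto simp: scale_right_distrib algebra_simps)
      then show "y \<in> ?R" by (auto simp: coset_def)
    qed
    show "?R \<subseteq> ?L"
    proof
      fix y assume "y \<in> ?R"
      then obtain u where "u \<in> U" "y = scale c (w + 0) + u"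
        by (auto simp: coset_def)
      then show "y \<in> ?L" using subspace_0[OF U] unfolding coset_def by blast
    qed
  qed
  then show ?thesis by (simp add: quotient_space_def)
qed

definition linear_iso ::
  "('a \<Rightarrow> 'b) \<Rightarrow> ('k, 'a) linear_structure \<Rightarrow> ('k, 'b) linear_structure \<Rightarrow> bool"
  where "linear_iso h Q R \<longleftrightarrow>
    bij_betw h (points Q) (points R) \<and>
    (\<forall>A\<in>points Q. \<forall>B\<in>points Q. h (add Q A B) = add R (h A) (h B)) \<and>
    (\<forall>c. \<forall>A\<in>points Q. h (smul Q c A) = smul R c (h A))"

definition fun_scale :: "('k \<Rightarrow> 'v \<Rightarrow> 'v) \<Rightarrow> 'k \<Rightarrow> ('x \<Rightarrow> 'v) \<Rightarrow> ('x \<Rightarrow> 'v)"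
  where "fun_scale s c f = (\<lambda>x. s c (f x))"


section \<open>Hom-Lie algebras, derivations and representations\<close>

text \<open>The twist \<open>phi\<close> is an automorphism throughout. The bracket is a linear map on the exterior
  square, hence alternating; over fields of characteristic \<open>2\<close> this is stronger than
  \<open>br x y = - br y x\<close>.\<close>

locale hom_lie_algebra = vector_space scale
  for scale :: "'k::field \<Rightarrow> 'g::ab_group_add \<Rightarrow> 'g" +
  fixes br :: "'g \<Rightarrow> 'g \<Rightarrow> 'g"
    and phi :: "'g \<Rightarrow> 'g"
  assumes br_linear_right: "Vector_Spaces.linear scale scale (\<lambda>y. br x y)"
    and br_linear_left: "Vector_Spaces.linear scale scale (\<lambda>x. br x y)"
    and br_alternating: "br x x = 0"
    and phi_linear: "Vector_Spaces.linear scale scale phi"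
    and phi_br: "phi (br x y) = br (phi x) (phi y)"
    and phi_bij: "bij phi"
    and hom_jacobi:
      "br (phi x) (br y z) + br (phi y) (br z x) + br (phi z) (br x y) = 0"

definition ad :: "('g \<Rightarrow> 'g \<Rightarrow> 'g) \<Rightarrow> 'g \<Rightarrow> ('g \<Rightarrow> 'g)"
  where "ad br x = (\<lambda>y. br x y)"

definition Ad :: "('v \<Rightarrow> 'v) \<Rightarrow> ('v \<Rightarrow> 'v) \<Rightarrow> ('v \<Rightarrow> 'v)"
  where "Ad beta A = beta \<circ> A \<circ> inv beta"

definition Der ::
  "('k::field \<Rightarrow> 'g::ab_group_add \<Rightarrow> 'g) \<Rightarrow> ('g \<Rightarrow> 'g \<Rightarrow> 'g) \<Rightarrow> ('g \<Rightarrow> 'g) \<Rightarrow> ('g \<Rightarrow> 'g) set"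
  where "Der scale br phi =
    {D. Vector_Spaces.linear scale scale D \<and>
        (\<forall>x y. D (br x y) = br (phi x) (Ad (inv phi) D y) + br (Ad (inv phi) D x) (phi y))}"

definition Inn :: "('g \<Rightarrow> 'g \<Rightarrow> 'g) \<Rightarrow> ('g \<Rightarrow> 'g) set"
  where "Inn br = range (ad br)"

definition Out ::
  "('k::field \<Rightarrow> 'g::ab_group_add \<Rightarrow> 'g) \<Rightarrow> ('g \<Rightarrow> 'g \<Rightarrow> 'g) \<Rightarrow> ('g \<Rightarrow> 'g)
    \<Rightarrow> ('k, ('g \<Rightarrow> 'g) set) linear_structure"
  where "Out scale br phi = quotient_space (fun_scale scale) (Der scale br phi) (Inn br)"

locale hom_lie_representation =
  hom_lie_algebra scale br phi + V: vector_space scaleV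
  for scale :: "'k::field \<Rightarrow> 'g::ab_group_add \<Rightarrow> 'g"
    and br :: "'g \<Rightarrow> 'g \<Rightarrow> 'g"
    and phi :: "'g \<Rightarrow> 'g"
    and scaleV :: "'k \<Rightarrow> 'v::ab_group_add \<Rightarrow> 'v" +
  fixes rho :: "'g \<Rightarrow> 'v \<Rightarrow> 'v"
    and beta :: "'v \<Rightarrow> 'v"
  assumes beta_linear: "Vector_Spaces.linear scaleV scaleV beta"
    and rho_endomorphism: "Vector_Spaces.linear scaleV scaleV (rho x)"
    and rho_linear: "Vector_Spaces.linear scale scaleV (\<lambda>x. rho x v)"
    and rho_twist: "rho (phi x) \<circ> beta = beta \<circ> rho x"
    and rho_br: "rho (br x y) \<circ> beta = (rho (phi x) \<circ> rho y) - (rho (phi y) \<circ> rho x)"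


section \<open>Cohomology\<close>

text \<open>A \<open>k\<close>-cochain, that is, an alternating \<open>k\<close>-linear map, is a function on argument lists that
  is extended by \<open>0\<close> to all lists of length different from \<open>k\<close>.\<close>

definition cochains ::
  "('k::field \<Rightarrow> 'g::ab_group_add \<Rightarrow> 'g) \<Rightarrow> ('k \<Rightarrow> 'v::ab_group_add \<Rightarrow> 'v) \<Rightarrow> nat
    \<Rightarrow> ('g list \<Rightarrow> 'v) set"
  where "cochains scale scaleV k =
    {f. (\<forall>xs. length xs \<noteq> k \<longrightarrow> f xs = 0) \<and>
        (\<forall>xs i. length xs = k \<and> i < k \<longrightarrow>
           Vector_Spaces.linear scale scaleV (\<lambda>x. f (xs[i := x]))) \<and>
        (\<forall>xs i j. length xs = k \<and> i < j \<and> j < k \<and> xs ! i = xs ! j \<longrightarrow> f xs = 0)}"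

definition omit :: "nat \<Rightarrow> 'a list \<Rightarrow> 'a list"
  where "omit i xs = take i xs @ drop (Suc i) xs"

text \<open>Arguments are indexed from \<open>0\<close> here, so the sign of the \<open>i\<close>-th term of the first sum is
  \<open>(-1)^i\<close>, while the signs in the second sum are unaffected by the shift.\<close>

definition coboundary_map ::
  "('g \<Rightarrow> 'g \<Rightarrow> 'g) \<Rightarrow> ('g \<Rightarrow> 'g) \<Rightarrow> ('k::field \<Rightarrow> 'v::ab_group_add \<Rightarrow> 'v)
    \<Rightarrow> ('g \<Rightarrow> 'v \<Rightarrow> 'v) \<Rightarrow> ('v \<Rightarrow> 'v) \<Rightarrow> nat \<Rightarrow> ('g list \<Rightarrow> 'v) \<Rightarrow> ('g list \<Rightarrow> 'v)"
  where "coboundary_map br phi scaleV rho beta k f = (\<lambda>xs.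
    if length xs = k + 1 then
      (\<Sum>i<k + 1. scaleV ((-1) ^ i) (rho (xs ! i) (f (map (inv phi) (omit i xs))))) +
      (\<Sum>j<k + 1. \<Sum>i<j. scaleV ((-1) ^ (i + j))
         (beta (f (br ((inv phi ^^ 2) (xs ! i)) ((inv phi ^^ 2) (xs ! j))
                   # map (inv phi) (omit i (omit j xs))))))
    else 0)"

definition cocycles ::
  "('k::field \<Rightarrow> 'g::ab_group_add \<Rightarrow> 'g) \<Rightarrow> ('g \<Rightarrow> 'g \<Rightarrow> 'g) \<Rightarrow> ('g \<Rightarrow> 'g)
    \<Rightarrow> ('k \<Rightarrow> 'v::ab_group_add \<Rightarrow> 'v) \<Rightarrow> ('g \<Rightarrow> 'v \<Rightarrow> 'v) \<Rightarrow> ('v \<Rightarrow> 'v) \<Rightarrow> nat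
    \<Rightarrow> ('g list \<Rightarrow> 'v) set"
  where "cocycles scale br phi scaleV rho beta k =
    {f \<in> cochains scale scaleV k. coboundary_map br phi scaleV rho beta k f = 0}"

definition coboundaries ::
  "('k::field \<Rightarrow> 'g::ab_group_add \<Rightarrow> 'g) \<Rightarrow> ('g \<Rightarrow> 'g \<Rightarrow> 'g) \<Rightarrow> ('g \<Rightarrow> 'g)
    \<Rightarrow> ('k \<Rightarrow> 'v::ab_group_add \<Rightarrow> 'v) \<Rightarrow> ('g \<Rightarrow> 'v \<Rightarrow> 'v) \<Rightarrow> ('v \<Rightarrow> 'v) \<Rightarrow> nat
    \<Rightarrow> ('g list \<Rightarrow> 'v) set"
  where "coboundaries scale br phi scaleV rho beta k =
    (case k of 0 \<Rightarrow> {0}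
     | Suc l \<Rightarrow> coboundary_map br phi scaleV rho beta l ` cochains scale scaleV l)"

definition cohomology ::
  "('k::field \<Rightarrow> 'g::ab_group_add \<Rightarrow> 'g) \<Rightarrow> ('g \<Rightarrow> 'g \<Rightarrow> 'g) \<Rightarrow> ('g \<Rightarrow> 'g)
    \<Rightarrow> ('k \<Rightarrow> 'v::ab_group_add \<Rightarrow> 'v) \<Rightarrow> ('g \<Rightarrow> 'v \<Rightarrow> 'v) \<Rightarrow> ('v \<Rightarrow> 'v) \<Rightarrow> nat
    \<Rightarrow> ('k, ('g list \<Rightarrow> 'v) set) linear_structure"
  where "cohomology scale br phi scaleV rho beta k =
    quotient_space (fun_scale scaleV)
      (cocycles scale br phi scaleV rho beta k)
      (coboundaries scale br phi scaleV rho beta k)"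


section \<open>Conventions for the adjoint representation\<close>

lemma (in hom_lie_algebra) br_add:
  "br x (y + z) = br x y + br x z" "br (x + y) z = br x z + br y z"
  using br_linear_right[of x] br_linear_left[of z]
  by (auto simp: Vector_Spaces.linear_iff)

lemma (in hom_lie_algebra) br_skew: "br x y = - br y x"
proof -
  have "0 = br (x + y) (x + y)" by (simp only: br_alternating)
  also have "\<dots> = (br x x + br y x) + (br x y + br y y)" by (simp only: br_add)
  finally have "br x y + br y x = 0" by (simp add: br_alternating add.commute)
  then show ?thesis by (simp only: eq_neg_iff_add_eq_0)
qed

lemma (in hom_lie_algebra) adjoint_representation:
  "hom_lie_representation scale br phi scale (ad br) phi"
proof (intro hom_lie_representation.intro hom_lie_representation_axioms.intro)
  show "hom_lie_algebra scale br phi" by unfold_locales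
  show "vector_space scale" by unfold_locales
  show "Vector_Spaces.linear scale scale phi" by (rule phi_linear)
  fix x y
  show "Vector_Spaces.linear scale scale (ad br x)"
    unfolding ad_def by (rule br_linear_right)
  show "Vector_Spaces.linear scale scale (\<lambda>x. ad br x y)"
    unfolding ad_def by (rule br_linear_left)
  show "ad br (phi x) \<circ> phi = phi \<circ> ad br x"
    by (auto simp: ad_def phi_br)
  have "br (br x y) (phi z) = br (phi x) (br y z) - br (phi y) (br x z)" for z
  proof -
    have "br (phi y) (br z x) + br (phi y) (br x z) = br (phi y) 0"
      by (subst br_skew[of z x]) (simp flip: br_add)
    also have "\<dots> = 0"
      using br_add(1)[of "phi y" 0 0] by simp
    finally have "br (phi y) (br z x) = - br (phi y) (br x z)"
      by (rule eq_neg_iff_add_eq_0[THEN iffD2])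
    moreover have "br (br x y) (phi z) = - br (phi z) (br x y)"
      by (rule br_skew)
    ultimately show ?thesis
      using hom_jacobi[of x y z] by (simp add: add_eq_0_iff)
  qed
  then show "ad br (br x y) \<circ> phi = (ad br (phi x) \<circ> ad br y) - (ad br (phi y) \<circ> ad br x)"
    by (auto simp: ad_def fun_eq_iff)
qed

text \<open>The identification of \<open>1\<close>-cochains with linear maps.\<close>

definition cochain1_map :: "('g list \<Rightarrow> 'v) \<Rightarrow> ('g \<Rightarrow> 'v)"
  where "cochain1_map f = (\<lambda>x. f [x])"

lemma cochain1_map_bij:
  "bij_betw cochain1_map (cochains scale scaleV 1) {D. Vector_Spaces.linear scale scaleV D}"
proof (rule bij_betwI[where g = "\<lambda>D xs. if length xs = 1 then D (hd xs) else 0"])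
  show "cochain1_map \<in> cochains scale scaleV 1 \<rightarrow> {D. Vector_Spaces.linear scale scaleV D}"
  proof
    fix f assume "f \<in> cochains scale scaleV 1"
    then have "Vector_Spaces.linear scale scaleV (\<lambda>x. f ([0][0 := x]))"
      unfolding cochains_def by (fastforce dest: spec[where x = "[0]"])
    then show "cochain1_map f \<in> {D. Vector_Spaces.linear scale scaleV D}"
      by (simp add: cochain1_map_def)
  qed
  show "(\<lambda>D xs. if length xs = 1 then D (hd xs) else 0)
      \<in> {D. Vector_Spaces.linear scale scaleV D} \<rightarrow> cochains scale scaleV 1"
    by (auto simp: cochains_def length_Suc_conv)
qed (auto simp: cochains_def cochain1_map_def fun_eq_iff length_Suc_conv)

end

theory Submission
  imports Defs
begin

text \<open>
  A \<open>1\<close>-cochain with values in the adjoint representation is the same thing as an endomorphism \<open>D\<close>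
  of \<open>\<gg>\<close>. Under this identification the cocycle condition at \<open>(\<phi>\<^sup>2 x, \<phi>\<^sup>2 y)\<close> reads
  \<open>[\<phi>\<^sup>2 x, D (\<phi> y)] - [\<phi>\<^sup>2 y, D (\<phi> x)] - \<phi> (D [x, y]) = 0\<close>, and its image under \<open>\<phi>\<^sup>-\<^sup>1\<close> is the
  defining identity of a derivation, because \<open>\<phi>\<close> is an automorphism and the bracket is skew; as
  \<open>\<phi>\<^sup>2\<close> is onto, nothing is lost by looking at such pairs only (\<open>cocycle_iff_derivation\<close>). The
  coboundary of \<open>v\<close> is \<open>y \<mapsto> [y, v]\<close>, the inner derivation of \<open>-v\<close> (\<open>coboundaries_eq_Inn\<close>). Hence
  the identification carries cocycles onto \<open>Der(\<gg>)\<close> and coboundaries onto \<open>Inn(\<gg>)\<close>, and it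
  descends to the quotients (\<open>linear_iso_quotient_space\<close>).
\<close>

text \<open>Taking images under \<open>T\<close> commutes with the operations on cosets by linearity alone; injectivity
  of \<open>T\<close> on a set \<open>C\<close> that contains all the cosets makes \<open>A \<mapsto> T ` A\<close> injective.\<close>

lemma linear_iso_quotient_space:
  fixes T :: "'a::ab_group_add \<Rightarrow> 'b::ab_group_add"
  assumes add: "\<And>f g. T (f + g) = T f + T g"
    and smul: "\<And>c f. T (s c f) = s' c (T f)"
    and inj: "inj_on T C"
    and closed: "\<And>f g. f \<in> C \<Longrightarrow> g \<in> C \<Longrightarrow> f + g \<in> C"
    and W: "W \<subseteq> C" and U: "U \<subseteq> C"
  shows "linear_iso (\<lambda>A. T ` A) (quotient_space s W U) (quotient_space s' (T ` W) (T ` U))"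
proof -
  have coset: "T ` coset w U = coset (T w) (T ` U)" for w
    by (simp add: coset_def image_image add)
  have "coset w U \<in> Pow C" if "w \<in> W" for w
    using that W U closed by (auto simp: coset_def)
  then have "inj_on ((`) T) ((\<lambda>w. coset w U) ` W)"
    by (intro inj_on_subset[OF inj_on_image_Pow[OF inj]]) blast
  moreover have "(`) T ` (\<lambda>w. coset w U) ` W = (\<lambda>w. coset w (T ` U)) ` T ` W"
    by (simp add: image_image coset)
  ultimately have "bij_betw (\<lambda>A. T ` A) ((\<lambda>w. coset w U) ` W) ((\<lambda>w. coset w (T ` U)) ` T ` W)"
    by (simp add: bij_betw_def)
  moreover have "T ` {a + b |a b. a \<in> A \<and> b \<in> B} = {a + b |a b. a \<in> T ` A \<and> b \<in> T ` B}" for A B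
  proof -
    have "T ` {a + b |a b. a \<in> A \<and> b \<in> B} = {T a + T b |a b. a \<in> A \<and> b \<in> B}"
      by (auto simp flip: add)
    then show ?thesis by blast
  qed
  moreover have "T ` {s c a + u |a u. a \<in> A \<and> u \<in> U}
      = {s' c a + u |a u. a \<in> T ` A \<and> u \<in> T ` U}" for c A
  proof -
    have "T ` {s c a + u |a u. a \<in> A \<and> u \<in> U} = {s' c (T a) + T u |a u. a \<in> A \<and> u \<in> U}"
      by (auto simp flip: add smul)
    then show ?thesis by blast
  qed
  ultimately show ?thesis
    by (simp add: linear_iso_def quotient_space_def)
qed

context hom_lie_algebra
begin

abbreviation d :: "nat \<Rightarrow> ('g list \<Rightarrow> 'g) \<Rightarrow> 'g list \<Rightarrow> 'g"
  where "d \<equiv> coboundary_map br phi scale (ad br) phi"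

lemma inv_phi_phi [simp]: "inv phi (phi x) = x"
  using phi_bij by (simp add: bij_is_inj)

lemma phi_inv_phi [simp]: "phi (inv phi x) = x"
  using phi_bij by (simp add: bij_is_surj surj_f_inv_f)

lemma phi_eq_iff: "phi x = phi y \<longleftrightarrow> x = y"
  using phi_bij by (simp add: bij_is_inj inj_eq)

lemma all_phi_phi_iff: "(\<forall>x y. P (phi (phi x)) (phi (phi y))) \<longleftrightarrow> (\<forall>x y. P x y)"
proof
  assume *: "\<forall>x y. P (phi (phi x)) (phi (phi y))"
  show "\<forall>x y. P x y"
  proof (intro allI)
    fix x y
    show "P x y"
      using *[rule_format, of "inv phi (inv phi x)" "inv phi (inv phi y)"] by simp
  qed
qed simp

lemma phi_add: "phi (x + y) = phi x + phi y"
  using phi_linear by (simp add: Vector_Spaces.linear_iff)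

lemma br_minus_right: "br x (- y) = - br x y"
  using br_add(1)[of x y "- y"] br_add(1)[of x 0 0]
  by (simp add: eq_neg_iff_add_eq_0 add.commute)

lemma d0_eq: "d 0 f [y] = br y (f [])"
  by (simp add: coboundary_map_def ad_def omit_def)

lemma d1_eq:
  "d 1 f [x, y] = br x (f [inv phi y]) - br y (f [inv phi x])
     - phi (f [br (inv phi (inv phi x)) (inv phi (inv phi y))])"
  by (simp add: coboundary_map_def ad_def omit_def numeral_2_eq_2)

lemma Ad_inv_phi: "Ad (inv phi) D x = inv phi (D (phi x))"
  using phi_bij by (simp add: Ad_def inv_inv_eq)

lemma cocycle_iff_derivation:
  assumes f: "f \<in> cochains scale scale 1"
  shows "d 1 f = 0 \<longleftrightarrow> cochain1_map f \<in> Der scale br phi"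
proof -
  define D where "D = cochain1_map f"
  have lin: "Vector_Spaces.linear scale scale D"
    using bij_betw_apply[OF cochain1_map_bij f] by (simp add: D_def)
  have "d 1 f = 0 \<longleftrightarrow> (\<forall>x y. d 1 f [x, y] = 0)"
  proof
    assume "\<forall>x y. d 1 f [x, y] = 0"
    moreover have "d 1 f xs = 0" if "length xs \<noteq> 2" for xs
      using that by (simp add: coboundary_map_def numeral_2_eq_2)
    moreover have "\<exists>x y. xs = [x, y]" if "length xs = 2" for xs :: "'g list"
      using that by (auto simp: numeral_2_eq_2 length_Suc_conv)
    ultimately have "d 1 f xs = 0" for xs
      by (cases "length xs = 2") blast+
    then show "d 1 f = 0" by (simp add: fun_eq_iff)
  qed simp
  also have "\<dots> \<longleftrightarrow> (\<forall>x y. d 1 f [phi (phi x), phi (phi y)] = 0)"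
    by (rule all_phi_phi_iff[symmetric])
  also have "\<dots> \<longleftrightarrow> (\<forall>x y. phi (D (br x y))
      = br (phi (phi x)) (D (phi y)) + br (D (phi x)) (phi (phi y)))"
  proof -
    have "d 1 f [phi (phi x), phi (phi y)] = br (phi (phi x)) (D (phi y))
        + br (D (phi x)) (phi (phi y)) - phi (D (br x y))" for x y
      using br_skew[of "phi (phi y)" "D (phi x)"]
      by (simp add: d1_eq D_def cochain1_map_def del: One_nat_def)
    then have "d 1 f [phi (phi x), phi (phi y)] = 0 \<longleftrightarrow> phi (D (br x y))
        = br (phi (phi x)) (D (phi y)) + br (D (phi x)) (phi (phi y))" for x y
      by (simp only: right_minus_eq) (rule eq_commute)
    then show ?thesis by (simp only:)
  qed
  also have "\<dots> \<longleftrightarrow> (\<forall>x y. D (br x y)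
      = br (phi x) (Ad (inv phi) D y) + br (Ad (inv phi) D x) (phi y))"
  proof -
    have "br (phi (phi x)) (D (phi y)) + br (D (phi x)) (phi (phi y))
        = phi (br (phi x) (Ad (inv phi) D y) + br (Ad (inv phi) D x) (phi y))" for x y
      by (simp add: Ad_inv_phi phi_add phi_br)
    then show ?thesis by (simp only: phi_eq_iff)
  qed
  also have "\<dots> \<longleftrightarrow> D \<in> Der scale br phi"
    using lin by (simp add: Der_def)
  finally show ?thesis by (simp add: D_def)
qed

lemma cocycles_eq_Der:
  "cochain1_map ` cocycles scale br phi scale (ad br) phi 1 = Der scale br phi"
proof -
  have "Der scale br phi \<subseteq> cochain1_map ` cochains scale scale 1"
    using cochain1_map_bij[of scale scale] by (auto simp: bij_betw_def Der_def)
  then show ?thesis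
    by (auto simp: cocycles_def cocycle_iff_derivation simp del: One_nat_def)
qed

lemma coboundaries_eq_Inn:
  "cochain1_map ` coboundaries scale br phi scale (ad br) phi 1 = Inn br"
proof -
  have d0: "cochain1_map (d 0 f) = ad br (- f [])" for f
  proof
    fix y
    have "br y (f []) = br (- f []) y"
      using br_skew[of "- f []" y] by (simp add: br_minus_right)
    then show "cochain1_map (d 0 f) y = ad br (- f []) y"
      by (simp add: cochain1_map_def d0_eq ad_def)
  qed
  have "ad br v \<in> (\<lambda>f. cochain1_map (d 0 f)) ` cochains scale scale 0" for v
  proof
    \<comment> \<open>the \<open>0\<close>-cochain \<open>-v\<close>: \<open>d\<close> puts its argument on the left of the bracket, \<open>ad\<close> puts \<open>v\<close> there\<close>
    let ?f = "\<lambda>xs. if xs = [] then - v else 0"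
    show "?f \<in> cochains scale scale 0" by (simp add: cochains_def)
    show "ad br v = cochain1_map (d 0 ?f)" by (simp only: d0) simp
  qed
  then show ?thesis
    by (auto simp: coboundaries_def Inn_def image_image d0)
qed

end

theorem proposition3p7:
  fixes scale :: "'k::field \<Rightarrow> 'g::ab_group_add \<Rightarrow> 'g"
    and br :: "'g \<Rightarrow> 'g \<Rightarrow> 'g"
    and phi :: "'g \<Rightarrow> 'g"
  assumes "hom_lie_algebra scale br phi"
  shows "linear_iso (\<lambda>A. cochain1_map ` A)
           (cohomology scale br phi scale (ad br) phi 1)
           (Out scale br phi)"
proof -
  interpret hom_lie_algebra scale br phi by fact
  let ?Z = "cocycles scale br phi scale (ad br) phi 1"
  let ?B = "coboundaries scale br phi scale (ad br) phi 1"
  \<comment> \<open>All functions of one argument, linear or not: a set closed under addition that contains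
    the cosets, on which \<open>cochain1_map\<close> is visibly injective.\<close>
  let ?C = "{f :: 'g list \<Rightarrow> 'g. \<forall>xs. length xs \<noteq> 1 \<longrightarrow> f xs = 0}"
  have "inj_on cochain1_map ?C"
  proof (rule inj_onI, rule ext)
    fix f g :: "'g list \<Rightarrow> 'g" and xs
    assume "f \<in> ?C" "g \<in> ?C" "cochain1_map f = cochain1_map g"
    then show "f xs = g xs"
      by (cases "length xs = 1") (auto simp: cochain1_map_def length_Suc_conv fun_eq_iff)
  qed
  moreover have "?Z \<subseteq> ?C"
    by (auto simp: cocycles_def cochains_def)
  moreover have "?B \<subseteq> ?C"
    by (auto simp: coboundaries_def coboundary_map_def)
  ultimately have "linear_iso (\<lambda>A. cochain1_map ` A)
      (quotient_space (fun_scale scale) ?Z ?B)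
      (quotient_space (fun_scale scale) (cochain1_map ` ?Z) (cochain1_map ` ?B))"
    by (intro linear_iso_quotient_space[where C = ?C])
      (auto simp: cochain1_map_def fun_scale_def fun_eq_iff)
  then show ?thesis
    by (simp only: cohomology_def Out_def cocycles_eq_Der coboundaries_eq_Inn)
qed

end
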